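(* Let $\lambda\neq0$ be a complex number, $u\in\mathbb{C}$ with $u\neq1$, and $r\in\mathbb{N}$. For every integer $m\ge0$, \[ h^{(r)}_{m,\lambda}(x|u)=\sum_{n=0}^{m}H^{(r)}_n(x|u)\,\lambda^{m-n}S_1(m,n). \]
   Context: For $\lambda\neq0$, $(x|\lambda)_0=1$ and $(x|\lambda)_n=x(x-\lambda)\cdots(x-(n-1)\lambda)$; $(1+\lambda t)^{x/\lambda}$ denotes the formal power series $\sum_{n\ge0}(x|\lambda)_n t^n/n!$. The degenerate Frobenius–Euler polynomials of order $r$ are defined by \[ \left(\frac{1-u}{(1+\lambda t)^{1/\lambda}-u}\right)^r(1+\lambda t)^{x/\lambda}=\sum_{n=0}^\infty h^{(r)}_{n,\lambda}(x|u)\frac{t^n}{n!}, \] and the higher-order Frobenius–Euler polynomials by \[ \left(\frac{1-u}{e^t-u}\right)^r e^{xt}=\sum_{n=0}^\infty H^{(r)}_n(x|u)\frac{t^n}{n!}. \] $S_1(m,n)$ are the (signed) Stirling numbers of the first kind, defined by $(x)_m=\sum_{n=0}^m S_1(m,n)x^n$, where $(x)_0=1$, $(x)_m=x(x-1)\cdots(x-m+1)$. *)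

theory Defs
  imports Complex_Main
    "HOL-Computational_Algebra.Polynomial"
    "HOL-Computational_Algebra.Formal_Power_Series"
begin

text \<open>The generalized falling factorial \<open>(x|\<lambda>)\<^sub>n = x (x - \<lambda>) \<cdots> (x - (n - 1) \<lambda>)\<close>; the ordinary
  falling factorial \<open>(x)\<^sub>n\<close> is the case \<open>\<lambda> = 1\<close>.\<close>

definition gen_ffact :: "'a::comm_ring_1 \<Rightarrow> 'a \<Rightarrow> nat \<Rightarrow> 'a" where
  "gen_ffact x lam n = (\<Prod>k<n. x - of_nat k * lam)"

text \<open>The series \<open>(1 + \<lambda> t)\<^bsup>x/\<lambda>\<^esup>\<close> in \<open>t\<close>.\<close>

definition degenerate_exp :: "complex \<Rightarrow> complex \<Rightarrow> complex fps" where
  "degenerate_exp lam x = Abs_fps (\<lambda>n. gen_ffact x lam n / fact n)"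

text \<open>In the next two definitions the denominator has constant coefficient \<open>1 - u\<close>, so for
  \<open>u \<noteq> 1\<close> it is invertible and the quotient is the genuine quotient of power series.
  The polynomials are represented by their values at \<open>x\<close>.\<close>

definition degenerate_frobenius_euler ::
    "nat \<Rightarrow> complex \<Rightarrow> nat \<Rightarrow> complex \<Rightarrow> complex \<Rightarrow> complex" where
  "degenerate_frobenius_euler r lam n x u =
     fact n * fps_nth ((fps_const (1 - u) / (degenerate_exp lam 1 - fps_const u)) ^ r
                        * degenerate_exp lam x) n"

definition frobenius_euler :: "nat \<Rightarrow> nat \<Rightarrow> complex \<Rightarrow> complex \<Rightarrow> complex" where
  "frobenius_euler r n x u =
     fact n * fps_nth ((fps_const (1 - u) / (fps_exp 1 - fps_const u)) ^ r * fps_exp x) n"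

text \<open>Signed Stirling numbers of the first kind: the coefficients of the polynomial \<open>(X)\<^sub>m\<close>.\<close>

definition signed_stirling1 :: "nat \<Rightarrow> nat \<Rightarrow> int" where
  "signed_stirling1 m n = coeff (gen_ffact [:0, 1:] 1 m) n"

lemma degenerate_frobenius_euler_gf:
  "(fps_const (1 - u) / (degenerate_exp lam 1 - fps_const u)) ^ r * degenerate_exp lam x =
     Abs_fps (\<lambda>n. degenerate_frobenius_euler r lam n x u / fact n)"
  by (simp add: fps_eq_iff degenerate_frobenius_euler_def)

lemma frobenius_euler_gf:
  "(fps_const (1 - u) / (fps_exp 1 - fps_const u)) ^ r * fps_exp x =
     Abs_fps (\<lambda>n. frobenius_euler r n x u / fact n)"
  by (simp add: fps_eq_iff frobenius_euler_def)

lemma gen_ffact_X_Suc: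
  "gen_ffact [:0, 1:] 1 (Suc m) =
     pCons 0 (gen_ffact [:0, 1:] 1 m) - smult (int m) (gen_ffact [:0, 1:] 1 m)"
  by (simp add: gen_ffact_def of_nat_poly algebra_simps)

lemma signed_stirling1_0: "signed_stirling1 0 n = (if n = 0 then 1 else 0)"
  by (simp add: signed_stirling1_def gen_ffact_def)

lemma signed_stirling1_Suc_0: "signed_stirling1 (Suc m) 0 = - int m * signed_stirling1 m 0"
  by (simp add: signed_stirling1_def gen_ffact_X_Suc)

lemma signed_stirling1_Suc_Suc:
  "signed_stirling1 (Suc m) (Suc n) = signed_stirling1 m n - int m * signed_stirling1 m (Suc n)"
  by (simp add: signed_stirling1_def gen_ffact_X_Suc)

lemma signed_stirling1_eq_0: "m < n \<Longrightarrow> signed_stirling1 m n = 0"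
proof (induction m arbitrary: n)
  case (Suc m)
  then show ?case by (cases n) (simp_all add: signed_stirling1_Suc_Suc)
qed (simp add: signed_stirling1_0)

lemma gen_ffact_eq_sum_signed_stirling1:
  fixes x :: "'a::comm_ring_1"
  shows "gen_ffact x 1 m = (\<Sum>n\<le>m. of_int (signed_stirling1 m n) * x ^ n)"
proof (induction m)
  case 0
  show ?case by (simp add: gen_ffact_def signed_stirling1_0)
next
  case (Suc m)
  define S where "S n = (of_int (signed_stirling1 m n) :: 'a)" for n
  have top: "S (Suc m) = 0"
    by (simp add: S_def signed_stirling1_eq_0)
  have shift: "(\<Sum>n\<le>m. S n * x ^ n) = S 0 + (\<Sum>n\<le>m. S (Suc n) * x ^ Suc n)"
    using sum.atMost_Suc_shift[of "\<lambda>n. S n * x ^ n" m] by (simp add: top)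
  have "(\<Sum>n\<le>Suc m. of_int (signed_stirling1 (Suc m) n) * x ^ n) =
          - of_nat m * S 0 + (\<Sum>n\<le>m. (S n - of_nat m * S (Suc n)) * x ^ Suc n)"
    by (simp add: sum.atMost_Suc_shift signed_stirling1_Suc_0 signed_stirling1_Suc_Suc S_def
             del: sum.atMost_Suc)
  also have "\<dots> = x * (\<Sum>n\<le>m. S n * x ^ n) - of_nat m * (S 0 + (\<Sum>n\<le>m. S (Suc n) * x ^ Suc n))"
    by (simp add: algebra_simps sum_subtractf sum_distrib_left)
  also have "\<dots> = (x - of_nat m) * (\<Sum>n\<le>m. S n * x ^ n)"
    by (simp only: shift[symmetric] left_diff_distrib)
  also have "\<dots> = gen_ffact x 1 (Suc m)"
    using Suc by (simp add: gen_ffact_def S_def mult.commute)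
  finally show ?case ..
qed

end

theory Submission
  imports Defs
begin

text \<open>Let \<open>L = ln (1 + \<lambda> t) / \<lambda>\<close>. Substituting \<open>L\<close> for \<open>t\<close> turns the generating function of the
  Frobenius--Euler polynomials into that of the degenerate ones, because \<open>e\<^bsup>xL\<^esup> = (1 + \<lambda> t)\<^bsup>x/\<lambda>\<^esup>\<close>.
  The theorem is the comparison of coefficients, given
  \<open>L\<^sup>n / n! = (\<Sum>m. \<lambda>\<^bsup>m-n\<^esup> S\<^sub>1(m, n) t\<^sup>m / m!)\<close>; the latter follows from the differential
  equation \<open>(1 + \<lambda> t) (L\<^sup>n)' = n L\<^bsup>n-1\<^esup>\<close>, which is the recurrence of the Stirling numbers.\<close>

text \<open>As an antiderivative the series has its derivative at hand, and nothing is divided by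
  \<open>lam\<close>; for \<open>lam = 0\<close> it is \<open>fps_X\<close>.\<close>

definition degenerate_log :: "'a::field_char_0 \<Rightarrow> 'a fps" where
  "degenerate_log lam = fps_integral0 (inverse (1 + fps_const lam * fps_X))"

lemma degenerate_log_nth_0 [simp]: "fps_nth (degenerate_log lam) 0 = 0"
  by (simp add: degenerate_log_def fps_integral_def)

lemma fps_deriv_degenerate_log_power:
  "(1 + fps_const lam * fps_X) * fps_deriv (degenerate_log lam ^ Suc n) =
     of_nat (Suc n) * degenerate_log lam ^ n"
proof -
  have "(1 + fps_const lam * fps_X) * inverse (1 + fps_const lam * fps_X) = 1"
    by (rule inverse_mult_eq_1') simp
  moreover have "fps_deriv (degenerate_log lam) = inverse (1 + fps_const lam * fps_X)"
    by (simp add: degenerate_log_def fps_deriv_fps_integral)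
  ultimately show ?thesis
    by (simp add: fps_deriv_power' mult_ac del: power_Suc of_nat_Suc)
qed

text \<open>Compare coefficients of \<open>t^m\<close> in the differential equation.\<close>

lemma degenerate_log_power_nth_Suc:
  "of_nat (Suc m) * fps_nth (degenerate_log lam ^ Suc n) (Suc m) =
     of_nat (Suc n) * fps_nth (degenerate_log lam ^ n) m
       - lam * of_nat m * fps_nth (degenerate_log lam ^ Suc n) m"
proof -
  let ?D = "fps_deriv (degenerate_log lam ^ Suc n)"
  have "fps_nth (?D + fps_const lam * (fps_X * ?D)) m =
          fps_nth (fps_const (of_nat (Suc n)) * degenerate_log lam ^ n) m"
    using fps_deriv_degenerate_log_power[of lam n]
    by (simp add: algebra_simps fps_of_nat del: power_Suc of_nat_Suc)
  then show ?thesis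
    \<comment> \<open>Multiplication by \<open>fps_X\<close> shifts the index, so
      \<open>m = 0\<close> is separate.\<close>
    by (cases m) (simp_all add: algebra_simps del: power_Suc of_nat_Suc)
qed

lemma signed_stirling1_Suc_left_0: "signed_stirling1 (Suc m) 0 = 0"
  by (induction m) (simp_all add: signed_stirling1_Suc_0)

lemma degenerate_log_power_nth:
  fixes lam :: "'a::field_char_0"
  shows "fps_nth (degenerate_log lam ^ n) m =
           fact n / fact m * lam ^ (m - n) * of_int (signed_stirling1 m n)"
proof (induction m arbitrary: n)
  case 0
  show ?case by (simp add: signed_stirling1_0 fps_nth_power_0)
next
  case (Suc m)
  show ?case
  proof (cases n)
    case 0
    then show ?thesis by (simp add: signed_stirling1_Suc_left_0)
  next
    case (Suc k)
    let ?S = "\<lambda>j. of_int (signed_stirling1 m j) :: 'a"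
    \<comment> \<open>For \<open>k \<ge> m\<close> both truncated exponents are 0, but then the
      Stirling number vanishes.\<close>
    have shift: "lam * (lam ^ (m - Suc k) * ?S (Suc k)) = lam ^ (m - k) * ?S (Suc k)"
      by (cases "k < m") (simp_all add: signed_stirling1_eq_0 Suc_diff_Suc
          flip: power_Suc mult.assoc)
    have "of_nat (Suc m) * fps_nth (degenerate_log lam ^ Suc k) (Suc m) =
       fact (Suc k) / fact m *
         (lam ^ (m - k) * ?S k - of_nat m * (lam * (lam ^ (m - Suc k) * ?S (Suc k))))"
      unfolding degenerate_log_power_nth_Suc Suc.IH
      by (simp add: field_simps)
    also have "\<dots> = fact (Suc k) / fact m * lam ^ (m - k) * of_int (signed_stirling1 (Suc m) (Suc k))"
      unfolding shift signed_stirling1_Suc_Suc by (simp add: algebra_simps diff_divide_distrib)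
    finally have "fps_nth (degenerate_log lam ^ Suc k) (Suc m) =
       fact (Suc k) / fact m * lam ^ (m - k) * of_int (signed_stirling1 (Suc m) (Suc k)) /
         of_nat (Suc m)"
      by (simp only: nonzero_eq_divide_eq of_nat_eq_0_iff nat.distinct mult.commute not_False_eq_True)
    then show ?thesis
      by (simp add: Suc mult_ac del: power_Suc of_nat_Suc)
  qed
qed

text \<open>Pulling \<open>lam\<close> out of each factor reduces this to step 1 at
  \<open>x / lam\<close>.\<close>

lemma gen_ffact_eq_sum_signed_stirling1_scaled:
  fixes x lam :: "'a::field_char_0"
  assumes "lam \<noteq> 0"
  shows "gen_ffact x lam m = (\<Sum>n=0..m. x ^ n * lam ^ (m - n) * of_int (signed_stirling1 m n))"
proof -
  have "gen_ffact x lam m = (\<Prod>k<m. lam * (x / lam - of_nat k))"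
    unfolding gen_ffact_def using assms by (intro prod.cong) (simp_all add: right_diff_distrib)
  also have "\<dots> = lam ^ m * gen_ffact (x / lam) 1 m"
    by (simp add: gen_ffact_def prod.distrib)
  also have "\<dots> = (\<Sum>n=0..m. x ^ n * lam ^ (m - n) * of_int (signed_stirling1 m n))"
    unfolding gen_ffact_eq_sum_signed_stirling1 sum_distrib_left atMost_atLeast0
    by (rule sum.cong) (use assms in \<open>auto simp: power_diff power_divide\<close>)
  finally show ?thesis .
qed

lemma fps_compose_degenerate_log_nth:
  "fps_nth (f oo degenerate_log lam) m =
     (\<Sum>n=0..m. fact n * fps_nth f n * lam ^ (m - n) * of_int (signed_stirling1 m n)) / fact m"
  by (simp add: fps_compose_nth degenerate_log_power_nth sum_divide_distrib mult_ac)

text \<open>Since \<open>n!\<close> times the \<open>n\<close>-th coefficient of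
  \<open>fps_exp x\<close> is \<open>x^n\<close>, the composition formula yields the Stirling
  expansion of \<open>gen_ffact x lam m\<close>.\<close>

lemma fps_exp_compose_degenerate_log:
  assumes "lam \<noteq> 0"
  shows "fps_exp x oo degenerate_log lam = degenerate_exp lam x"
  using assms
  by (simp add: fps_eq_iff fps_compose_degenerate_log_nth degenerate_exp_def
      gen_ffact_eq_sum_signed_stirling1_scaled)

theorem theorem6:
  fixes lam u x :: complex and r m :: nat
  assumes "lam \<noteq> 0" and "u \<noteq> 1"
  shows "degenerate_frobenius_euler r lam m x u =
           (\<Sum>n=0..m. frobenius_euler r n x u * lam ^ (m - n) * of_int (signed_stirling1 m n))"
proof -
  let ?L = "degenerate_log lam"
  let ?F = "(fps_const (1 - u) / (fps_exp 1 - fps_const u)) ^ r * fps_exp x"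
  \<comment> \<open>The constant term \<open>1 - u\<close> makes the quotient a product with an
    inverse, which composition with \<open>?L\<close> respects because \<open>?L\<close> has zero
    constant term.\<close>
  have "fps_nth (fps_exp 1 - fps_const u) 0 \<noteq> 0"
    using assms by simp
  then have "(fps_const (1 - u) / (fps_exp 1 - fps_const u)) oo ?L =
      fps_const (1 - u) / (degenerate_exp lam 1 - fps_const u)"
    using assms by (simp add: fps_divide_unit fps_compose_mult_distrib fps_inverse_compose
        fps_compose_sub_distrib fps_exp_compose_degenerate_log degenerate_exp_def gen_ffact_def)
  then have "(fps_const (1 - u) / (degenerate_exp lam 1 - fps_const u)) ^ r * degenerate_exp lam x =
      ?F oo ?L"
    using assms by (simp add: fps_compose_mult_distrib fps_compose_power[symmetric]
        fps_exp_compose_degenerate_log)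
  then show ?thesis
    by (simp add: degenerate_frobenius_euler_def frobenius_euler_def
        fps_compose_degenerate_log_nth)
qed

end
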